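(* Let $m\ge2$ and let $x_1,\dotsc,x_{m}$ be integers, and let $y=\gcd(\sigma_{m-1}(x_1,\dotsc,x_m),\,x_1\cdots x_m)$. If $p$ is a prime number and $V_p=\max_{i\in\{1,\dots,m-1\}}\{v_p(x_i)\}$, then (a) $v_p(y)\geq v_p(x_1\cdots x_{m-1})-V_p$, and (b) $v_p(y)\leq v_p(x_1\cdots x_{m-1})+V_p$.
   Context: $\sigma_{m-1}(x_1,\dots,x_m)=\sum_{i=1}^m\prod_{j\ne i}x_j$ is the elementary symmetric polynomial of degree $m-1$. For a prime $p$ and an integer $n$, $v_p(n)$ is the exponent of the largest power of $p$ dividing $n$. *)

theory Defs
  imports "HOL-Library.Extended_Real" "HOL-Computational_Algebra.Computational_Algebra"
begin

text \<open>
  The library's \<^const>\<open>multiplicity\<close> sends 0 to 0, whereas every power of a prime divides 0.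
  Values are taken in \<^typ>\<open>ereal\<close> so that zero has infinite valuation and
  subtraction of finite valuations is not truncated.
\<close>

definition vp :: "nat \<Rightarrow> int \<Rightarrow> ereal" where
  "vp p n = (if n = 0 then \<infinity> else ereal (real (multiplicity (int p) n)))"

text \<open>The elementary symmetric polynomial of degree \<open>m - 1\<close> in \<open>x 1, \<dots>, x m\<close>.\<close>

definition sigma_pred :: "nat \<Rightarrow> (nat \<Rightarrow> int) \<Rightarrow> int" where
  "sigma_pred m x = (\<Sum>i\<in>{1..m}. \<Prod>j\<in>{1..m} - {i}. x j)"

end

theory Submission
  imports Defs
begin

text \<open>
  Put \<open>P = x\<^sub>1 \<cdots> x\<^bsub>m-1\<^esub>\<close>, \<open>t = x\<^sub>m\<close>, \<open>N = v\<^sub>p(P)\<close>, and let \<open>S\<close> be the sum of the \<open>P / x\<^sub>i\<close>, \<open>i < m\<close>,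
  so that \<open>y = gcd(P + t S, t P)\<close>. Each \<open>P / x\<^sub>i\<close>, and hence \<open>S\<close>, is divisible by \<open>p\<^bsup>N-V\<^esup>\<close>; this gives (a).
  If \<open>p\<^bsup>N+V+1\<^esup>\<close> divided \<open>y\<close>, then \<open>p\<^bsup>V+1\<^esup>\<close> would divide \<open>t\<close>, so \<open>p\<^bsup>N+1\<^esup>\<close> would divide \<open>t S\<close> and
  therefore \<open>P\<close>, which is absurd; this gives (b).
\<close>

text \<open>The summand omitting \<open>k\<close> is \<open>prod x A\<close>; every other summand
  keeps the factor \<open>x k\<close>. This isolates the last variable in
  \<open>sigma_pred\<close>.\<close>

lemma sum_prod_remove_insert:
  fixes x :: "'a \<Rightarrow> 'b :: comm_semiring_1"
  assumes "finite A" "k \<notin> A"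
  shows "(\<Sum>i\<in>insert k A. \<Prod>j\<in>insert k A - {i}. x j)
       = prod x A + x k * (\<Sum>i\<in>A. \<Prod>j\<in>A - {i}. x j)"
proof -
  have "(\<Prod>j\<in>insert k A - {i}. x j) = x k * (\<Prod>j\<in>A - {i}. x j)" if "i \<in> A" for i
  proof -
    have "insert k A - {i} = insert k (A - {i})"
      using assms that by auto
    then show ?thesis
      using assms by simp
  qed
  then show ?thesis
    using assms by (simp add: sum_distrib_left)
qed

text \<open>Multiplicities add over \<open>x i\<close> and its cofactor, so the cofactor loses at
  most \<open>v\<close> of the total.\<close>

lemma prime_power_dvd_prod_remove:
  fixes x :: "'a \<Rightarrow> int"
  assumes "finite A" "i \<in> A" "prime p" "prod x A \<noteq> 0" "multiplicity p (x i) \<le> v"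
  shows "p ^ (multiplicity p (prod x A) - v) dvd (\<Prod>j\<in>A - {i}. x j)"
proof -
  have split: "prod x A = x i * (\<Prod>j\<in>A - {i}. x j)"
    using assms by (simp add: prod.remove)
  with assms have "multiplicity p (prod x A) = multiplicity p (x i) + multiplicity p (\<Prod>j\<in>A - {i}. x j)"
    by (metis mult_eq_0_iff prime_elem_multiplicity_mult_distrib prime_imp_prime_elem)
  then show ?thesis
    using assms by (intro multiplicity_dvd') linarith
qed

lemma multiplicity_gcd_sum_prod_bounds:
  fixes P S t p :: int
  assumes p: "prime p" and P: "P \<noteq> 0"
    and S: "p ^ (multiplicity p P - v) dvd S"
  defines "y \<equiv> gcd (P + t * S) (t * P)"
  shows "y \<noteq> 0" and "multiplicity p P \<le> multiplicity p y + v"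
    and "multiplicity p y \<le> multiplicity p P + v"
proof -
  let ?N = "multiplicity p P"
  have unit: "\<not> is_unit p"
    using p not_prime_unit by blast
  show y: "y \<noteq> 0"
    using P unfolding y_def by auto
  have "p ^ (?N - v) dvd P"
    by (rule multiplicity_dvd') simp
  with S have "p ^ (?N - v) dvd y"
    unfolding y_def by simp
  then have "?N - v \<le> multiplicity p y"
    using y unit by (intro multiplicity_geI)
  then show "?N \<le> multiplicity p y + v"
    by simp
  show "multiplicity p y \<le> ?N + v"
  proof (rule ccontr)
    assume "\<not> ?thesis"
    then have dvd: "p ^ (?N + v + 1) dvd y"
      by (intro multiplicity_dvd') simp
    then have tP: "p ^ (?N + v + 1) dvd t * P" and sum: "p ^ (?N + v + 1) dvd P + t * S"
      unfolding y_def by simp_all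
    have "p ^ (v + 1) dvd t"
    \<comment> \<open>Zero is split off because \<open>multiplicity p 0 = 0\<close>, although every
      power of \<open>p\<close> divides 0.\<close>
    proof (cases "t = 0")
      case False
      have "?N + v + 1 \<le> multiplicity p (t * P)"
        using tP False P unit by (intro multiplicity_geI) auto
      also have "\<dots> = multiplicity p t + ?N"
        using p P False by (intro prime_elem_multiplicity_mult_distrib) auto
      finally show ?thesis
        by (intro multiplicity_dvd') simp
    qed simp
    \<comment> \<open>Even if \<open>?N - v\<close> truncates to 0, this exponent is at least
      \<open>?N + 1\<close>.\<close>
    then have "p ^ (v + 1 + (?N - v)) dvd t * S"
      using S unfolding power_add by (rule mult_dvd_mono)
    then have "p ^ (?N + 1) dvd t * S"
      by (rule power_le_dvd) simp
    moreover have "p ^ (?N + 1) dvd P + t * S"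
      using sum by (rule power_le_dvd) simp
    ultimately have "p ^ (?N + 1) dvd P"
      by (simp add: dvd_add_left_iff)
    then have "?N + 1 \<le> ?N"
      using P unit by (intro multiplicity_geI) auto
    then show False
      by simp
  qed
qed

theorem theorem4p3:
  fixes m p :: nat and x :: "nat \<Rightarrow> int" and y :: int and V :: ereal
  assumes "m \<ge> 2"
    and "y = gcd (sigma_pred m x) (\<Prod>i\<in>{1..m}. x i)"
    and "prime p"
    and "V = Max ((\<lambda>i. vp p (x i)) ` {1..m - 1})"
  shows "(V \<noteq> \<infinity> \<longrightarrow> vp p y \<ge> vp p (\<Prod>i\<in>{1..m - 1}. x i) - V)
       \<and> vp p y \<le> vp p (\<Prod>i\<in>{1..m - 1}. x i) + V"
proof -
  let ?A = "{1..m - 1}"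
  let ?S = "\<Sum>i\<in>?A. \<Prod>j\<in>?A - {i}. x j"
  have ins: "{1..m} = insert m ?A" and m: "m \<notin> ?A"
    using assms(1) by auto
  have y: "y = gcd (prod x ?A + x m * ?S) (x m * prod x ?A)"
    using assms(2) m unfolding sigma_pred_def ins sum_prod_remove_insert[OF finite_atLeastAtMost m]
    by simp
  have "V \<in> (\<lambda>i. vp p (x i)) ` ?A"
    unfolding assms(4) using assms(1) by (intro Max_in) auto
  then obtain k where k: "k \<in> ?A" "V = vp p (x k)"
    by auto
  have le: "vp p (x i) \<le> V" if "i \<in> ?A" for i
    unfolding assms(4) using that by (intro Max_ge) auto
  show ?thesis
  \<comment> \<open>If the maximum is attained at a zero entry, then \<open>V\<close> is infinite:
    the premise of (a) fails and the right side of (b) is infinite.\<close>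
  proof (cases "x k = 0")
    case True
    then show ?thesis
      using k by (simp add: vp_def)
  next
    case False
    define v where "v = multiplicity (int p) (x k)"
    have V: "V = ereal (real v)"
      using False k by (simp add: vp_def v_def)
    \<comment> \<open>A finite maximum excludes zero entries, whose \<open>vp\<close> is
      infinite.\<close>
    have nz: "x i \<noteq> 0" and mult_le: "multiplicity (int p) (x i) \<le> v" if "i \<in> ?A" for i
      using le[OF that] by (auto simp: vp_def V split: if_splits)
    have p: "prime (int p)"
      using assms(3) by simp
    have P: "prod x ?A \<noteq> 0"
      using nz by simp
    have "int p ^ (multiplicity (int p) (prod x ?A) - v) dvd ?S"
      using p P mult_le by (intro dvd_sum prime_power_dvd_prod_remove) auto
    note bounds = multiplicity_gcd_sum_prod_bounds[OF p P this, of "x m", folded y]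
    show ?thesis
      using bounds P by (simp add: vp_def V)
  qed
qed

end
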